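(* Let $\sigma$ be any one of the signatures $(\dot\cup)$, $(\dot\smile)$, $(\dot\cup,\emptyset)$, $(\dot\smile,\emptyset)$, $(\dot\smile,\mid)$ or $(\dot\smile,\mid,\emptyset)$. The class of $\lesssim$-completely $\sigma$-representable partial algebras is not closed under elementary equivalence.
   Context: For sets $S,T$, the disjoint union $S\mathbin{\dot\cup}T$ equals $S\cup T$ if $S\cap T=\emptyset$, and is undefined otherwise. A partial function is a functional set of ordered pairs. For partial functions $f,g$, the domain-disjoint union $f\mathbin{\dot\smile}g$ equals $f\cup g$ if the domains of $f$ and $g$ are disjoint, and is undefined otherwise; $f\mid g$ denotes the (total operation of) composition of partial functions; $\emptyset$ denotes the constant empty set. A partial algebra is a (possibly empty) set together with a sequence of partial operations of finite arities. An isomorphism between similar partial algebras is a bijection $\theta$ such that for each operation $\Omega$ and corresponding operation $\Pi$, $\Omega(a_1,\dots,a_k)$ is defined if and only if $\Pi(\theta(a_1),\dots,\theta(a_k))$ is defined, and then $\theta(\Omega(a_1,\dots,a_k))=\Pi(\theta(a_1),\dots,\theta(a_k))$. For $\sigma$ containing $\dot\cup$, a partial $\sigma$-algebra of sets is a subset of $\wp(X)$, for some set $X$, closed under $\dot\cup$ wherever defined and containing $\emptyset$ if $\emptyset$ is in $\sigma$; for $\sigma$ containing $\dot\smile$, a partial $\sigma$-algebra of partial functions is a set of partial functions closed under the operations in $\sigma$ wherever defined and containing $\emptyset$ if $\emptyset$ is in $\sigma$. A $\sigma$-representation of a partial algebra is an isomorphism to a partial $\sigma$-algebra of sets (if $\dot\cup$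 is in $\sigma$), respectively of partial functions (if $\dot\smile$ is in $\sigma$). The abstract symbol corresponding to $\dot\cup$ or $\dot\smile$ is $\dot\sqcup$, that for $\mid$ is $;$ and that for $\emptyset$ is $0$. On a partial $(\dot\sqcup,\dots)$-algebra $\mathfrak A$ define $a\lesssim b$ iff $a=b$ or there is $c\in\mathfrak A$ such that $a\mathbin{\dot\sqcup}c$ is defined and equals $b$ (a partial order if $\mathfrak A$ is representable). A subset $S$ of $\mathfrak A$ is pairwise combinable if $s\mathbin{\dot\sqcup}t$ is defined for all $s\neq t\in S$. A $\sigma$-representation $\theta$ is $\lesssim$-complete if for every pairwise-combinable subset $S$ of $\mathfrak A$ with a supremum $a$ with respect to $\lesssim$ we have $a^\theta=\bigcup_{s\in S}s^\theta$. $\mathfrak A$ is $\lesssim$-completely $\sigma$-representable if it has a $\lesssim$-complete $\sigma$-representation. Elementary equivalence is with respect to the first-order language (with equality) in which $\dot\sqcup$ is replaced by a ternary relation symbol $J$, with $J(a,b,c)$ iff $a\mathbin{\dot\sqcup}b$ is defined and equal to $c$, while $;$ is a binary function symbol and $0$ a constant symbol (when present). *)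

theory Defs
  imports Complex_Main
begin

section \<open>Signatures and partial algebras\<close>

datatype csym = DisjUnion | DomDisjUnion | Composition | EmptySet

datatype asym = Join | Comp | Zero

fun abstract_sym :: "csym \<Rightarrow> asym" where
  "abstract_sym DisjUnion = Join"
| "abstract_sym DomDisjUnion = Join"
| "abstract_sym Composition = Comp"
| "abstract_sym EmptySet = Zero"

fun arity :: "asym \<Rightarrow> nat" where
  "arity Join = 2"
| "arity Comp = 2"
| "arity Zero = 0"

text \<open>
  An operation is only meaningful on argument lists over the carrier whose length is the arity
  of the symbol; \<open>None\<close> means ``undefined''.  Symbols outside the signature under consideration
  are ignored throughout.
\<close>

record 'a palg =
  carrier :: "'a set"
  oper :: "asym \<Rightarrow> 'a list \<Rightarrow> 'a option"

definition args :: "'a palg \<Rightarrow> asym \<Rightarrow> 'a list set" where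
  "args A f = {xs. length xs = arity f \<and> set xs \<subseteq> carrier A}"

definition partial_algebra :: "csym set \<Rightarrow> 'a palg \<Rightarrow> bool" where
  "partial_algebra \<sigma> A \<longleftrightarrow>
     (\<forall>f \<in> abstract_sym ` \<sigma>. \<forall>xs \<in> args A f. \<forall>c. oper A f xs = Some c \<longrightarrow> c \<in> carrier A)"

definition isomorphism :: "csym set \<Rightarrow> 'a palg \<Rightarrow> 'b palg \<Rightarrow> ('a \<Rightarrow> 'b) \<Rightarrow> bool" where
  "isomorphism \<sigma> A B \<theta> \<longleftrightarrow> partial_algebra \<sigma> A \<and> partial_algebra \<sigma> B \<and>
     bij_betw \<theta> (carrier A) (carrier B) \<and>
     (\<forall>f \<in> abstract_sym ` \<sigma>. \<forall>xs \<in> args A f. oper B f (map \<theta> xs) = map_option \<theta> (oper A f xs))"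


section \<open>Concrete partial algebras\<close>

fun set_oper :: "asym \<Rightarrow> 'x set list \<Rightarrow> 'x set option" where
  "set_oper Join [S, T] = (if S \<inter> T = {} then Some (S \<union> T) else None)"
| "set_oper Zero [] = Some {}"
| "set_oper _ _ = None"

fun fun_oper :: "asym \<Rightarrow> ('x \<times> 'x) set list \<Rightarrow> ('x \<times> 'x) set option" where
  "fun_oper Join [f, g] = (if Domain f \<inter> Domain g = {} then Some (f \<union> g) else None)"
| "fun_oper Comp [f, g] = Some (f O g)"
| "fun_oper Zero [] = Some {}"
| "fun_oper _ _ = None"

definition set_palg :: "'x set set \<Rightarrow> 'x set palg" where
  "set_palg F = \<lparr>carrier = F, oper = set_oper\<rparr>"

definition fun_palg :: "('x \<times> 'x) set set \<Rightarrow> ('x \<times> 'x) set palg" where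
  "fun_palg F = \<lparr>carrier = F, oper = fun_oper\<rparr>"

text \<open>
  The closure conditions on a concrete algebra (including membership of the empty set when
  it is in the signature) are exactly \<^const>\<open>partial_algebra\<close> for the concrete operations.
\<close>

definition set_algebra :: "csym set \<Rightarrow> 'x set set \<Rightarrow> bool" where
  "set_algebra \<sigma> F \<longleftrightarrow> partial_algebra \<sigma> (set_palg F)"

definition fun_algebra :: "csym set \<Rightarrow> ('x \<times> 'x) set set \<Rightarrow> bool" where
  "fun_algebra \<sigma> F \<longleftrightarrow> (\<forall>f \<in> F. single_valued f) \<and> partial_algebra \<sigma> (fun_palg F)"

definition set_representation :: "csym set \<Rightarrow> 'a palg \<Rightarrow> ('a \<Rightarrow> 'x set) \<Rightarrow> bool" where
  "set_representation \<sigma> A \<theta> \<longleftrightarrow> (\<exists>F. set_algebra \<sigma> F \<and> isomorphism \<sigma> A (set_palg F) \<theta>)"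

definition fun_representation :: "csym set \<Rightarrow> 'a palg \<Rightarrow> ('a \<Rightarrow> ('x \<times> 'x) set) \<Rightarrow> bool" where
  "fun_representation \<sigma> A \<theta> \<longleftrightarrow> (\<exists>F. fun_algebra \<sigma> F \<and> isomorphism \<sigma> A (fun_palg F) \<theta>)"


section \<open>Complete representability\<close>

definition lesssim :: "'a palg \<Rightarrow> 'a \<Rightarrow> 'a \<Rightarrow> bool" where
  "lesssim A a b \<longleftrightarrow> a = b \<or> (\<exists>c \<in> carrier A. oper A Join [a, c] = Some b)"

definition pairwise_combinable :: "'a palg \<Rightarrow> 'a set \<Rightarrow> bool" where
  "pairwise_combinable A S \<longleftrightarrow> (\<forall>s \<in> S. \<forall>t \<in> S. s \<noteq> t \<longrightarrow> oper A Join [s, t] \<noteq> None)"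

definition is_supremum :: "'a palg \<Rightarrow> 'a set \<Rightarrow> 'a \<Rightarrow> bool" where
  "is_supremum A S a \<longleftrightarrow> a \<in> carrier A \<and> (\<forall>s \<in> S. lesssim A s a) \<and>
     (\<forall>b \<in> carrier A. (\<forall>s \<in> S. lesssim A s b) \<longrightarrow> lesssim A a b)"

text \<open>Partial functions are sets of pairs, so this applies to both kinds of representation.\<close>

definition lesssim_complete :: "'a palg \<Rightarrow> ('a \<Rightarrow> 'y set) \<Rightarrow> bool" where
  "lesssim_complete A \<theta> \<longleftrightarrow>
     (\<forall>S a. S \<subseteq> carrier A \<and> pairwise_combinable A S \<and> is_supremum A S a \<longrightarrow> \<theta> a = (\<Union>s \<in> S. \<theta> s))"

text \<open>
  Representability quantifies over representations on arbitrary base sets, whereas a definition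
  in HOL has to name the type the points are taken from.  A base of cardinality at most
  max(|A|, aleph-zero) always suffices, so the choice below is no restriction: the lemmas
  \<open>completely_representable_setI\<close> and \<open>completely_representable_funI\<close>
  show that a complete representation over any type whatsoever yields one over this type.
\<close>

type_synonym 'a point = "nat \<times> 'a list"

definition completely_representable :: "csym set \<Rightarrow> 'a palg \<Rightarrow> bool" where
  "completely_representable \<sigma> A \<longleftrightarrow>
     (DisjUnion \<in> \<sigma> \<and>
       (\<exists>\<theta> :: 'a \<Rightarrow> 'a point set. set_representation \<sigma> A \<theta> \<and> lesssim_complete A \<theta>)) \<or>
     (DomDisjUnion \<in> \<sigma> \<and>
       (\<exists>\<theta> :: 'a \<Rightarrow> ('a point \<times> 'a point) set. fun_representation \<sigma> A \<theta> \<and> lesssim_complete A \<theta>))"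


section \<open>First-order language and elementary equivalence\<close>

datatype tm = Var nat | Cmp tm tm | Zer

datatype fm = Eq tm tm | J tm tm tm | Neg fm | Conj fm fm | Ex nat fm

fun tm_vars :: "tm \<Rightarrow> nat set" where
  "tm_vars (Var n) = {n}"
| "tm_vars (Cmp t u) = tm_vars t \<union> tm_vars u"
| "tm_vars Zer = {}"

fun free_vars :: "fm \<Rightarrow> nat set" where
  "free_vars (Eq t u) = tm_vars t \<union> tm_vars u"
| "free_vars (J t u v) = tm_vars t \<union> tm_vars u \<union> tm_vars v"
| "free_vars (Neg p) = free_vars p"
| "free_vars (Conj p q) = free_vars p \<union> free_vars q"
| "free_vars (Ex n p) = free_vars p - {n}"

fun tm_syms :: "tm \<Rightarrow> asym set" where
  "tm_syms (Var n) = {}"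
| "tm_syms (Cmp t u) = {Comp} \<union> tm_syms t \<union> tm_syms u"
| "tm_syms Zer = {Zero}"

fun fm_syms :: "fm \<Rightarrow> asym set" where
  "fm_syms (Eq t u) = tm_syms t \<union> tm_syms u"
| "fm_syms (J t u v) = {Join} \<union> tm_syms t \<union> tm_syms u \<union> tm_syms v"
| "fm_syms (Neg p) = fm_syms p"
| "fm_syms (Conj p q) = fm_syms p \<union> fm_syms q"
| "fm_syms (Ex n p) = fm_syms p"

definition sentence :: "csym set \<Rightarrow> fm \<Rightarrow> bool" where
  "sentence \<sigma> p \<longleftrightarrow> free_vars p = {} \<and> fm_syms p \<subseteq> abstract_sym ` \<sigma>"

fun tm_val :: "'a palg \<Rightarrow> (nat \<Rightarrow> 'a) \<Rightarrow> tm \<Rightarrow> 'a" where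
  "tm_val A e (Var n) = e n"
| "tm_val A e (Cmp t u) = the (oper A Comp [tm_val A e t, tm_val A e u])"
| "tm_val A e Zer = the (oper A Zero [])"

fun sat :: "'a palg \<Rightarrow> (nat \<Rightarrow> 'a) \<Rightarrow> fm \<Rightarrow> bool" where
  "sat A e (Eq t u) \<longleftrightarrow> tm_val A e t = tm_val A e u"
| "sat A e (J t u v) \<longleftrightarrow> oper A Join [tm_val A e t, tm_val A e u] = Some (tm_val A e v)"
| "sat A e (Neg p) \<longleftrightarrow> \<not> sat A e p"
| "sat A e (Conj p q) \<longleftrightarrow> sat A e p \<and> sat A e q"
| "sat A e (Ex n p) \<longleftrightarrow> (\<exists>a \<in> carrier A. sat A (e(n := a)) p)"

text \<open>
  For a sentence the environment is irrelevant (\<open>models_sentence\<close> below), so it may take values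
  outside the carrier; this makes the definition work for the empty carrier too.
\<close>

definition models :: "'a palg \<Rightarrow> fm \<Rightarrow> bool" where
  "models A p \<longleftrightarrow> (\<forall>e. sat A e p)"

text \<open>
  Composition and zero are a function symbol and a constant symbol of the language, so the partial
  algebras that are structures for it are those on which these operations are everywhere defined.
\<close>

definition fo_structure :: "csym set \<Rightarrow> 'a palg \<Rightarrow> bool" where
  "fo_structure \<sigma> A \<longleftrightarrow> partial_algebra \<sigma> A \<and>
     (\<forall>f \<in> abstract_sym ` \<sigma> - {Join}. \<forall>xs \<in> args A f. oper A f xs \<noteq> None)"

definition elementarily_equivalent :: "csym set \<Rightarrow> 'a palg \<Rightarrow> 'b palg \<Rightarrow> bool" where
  "elementarily_equivalent \<sigma> A B \<longleftrightarrow> fo_structure \<sigma> A \<and> fo_structure \<sigma> B \<and>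
     (\<forall>p. sentence \<sigma> p \<longrightarrow> (models A p \<longleftrightarrow> models B p))"

lemma tm_val_cong: "(\<And>n. n \<in> tm_vars t \<Longrightarrow> e n = e' n) \<Longrightarrow> tm_val A e t = tm_val A e' t"
proof (induction t)
  case (Cmp t u)
  have "tm_val A e t = tm_val A e' t" by (rule Cmp.IH(1)) (simp add: Cmp.prems)
  moreover have "tm_val A e u = tm_val A e' u" by (rule Cmp.IH(2)) (simp add: Cmp.prems)
  ultimately show ?case by simp
qed simp_all

lemma sat_cong: "(\<And>n. n \<in> free_vars p \<Longrightarrow> e n = e' n) \<Longrightarrow> sat A e p \<longleftrightarrow> sat A e' p"
proof (induction p arbitrary: e e')
  case (Eq t u)
  then have "tm_val A e t = tm_val A e' t" "tm_val A e u = tm_val A e' u"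
    by (auto intro: tm_val_cong)
  then show ?case by simp
next
  case (J t u v)
  then have "tm_val A e t = tm_val A e' t" "tm_val A e u = tm_val A e' u"
    "tm_val A e v = tm_val A e' v"
    by (auto intro: tm_val_cong)
  then show ?case by simp
next
  case (Neg p)
  have "sat A e p \<longleftrightarrow> sat A e' p" by (rule Neg.IH) (simp add: Neg.prems)
  then show ?case by simp
next
  case (Conj p q)
  have "sat A e p \<longleftrightarrow> sat A e' p" by (rule Conj.IH(1)) (simp add: Conj.prems)
  moreover have "sat A e q \<longleftrightarrow> sat A e' q" by (rule Conj.IH(2)) (simp add: Conj.prems)
  ultimately show ?case by simp
next
  case (Ex n p)
  have "sat A (e(n := a)) p \<longleftrightarrow> sat A (e'(n := a)) p" for a
    by (rule Ex.IH) (simp add: Ex.prems)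
  then show ?case by simp
qed

lemma models_sentence: "sentence \<sigma> p \<Longrightarrow> models A p \<longleftrightarrow> sat A e p"
  unfolding models_def sentence_def using sat_cong[of p] by blast


section \<open>Independence of the type of points\<close>

text \<open>The defining property of the isomorphism, with argument lists spelled out.\<close>

lemma ball_args:
  "(\<forall>xs \<in> args A Join. P xs) \<longleftrightarrow> (\<forall>a \<in> carrier A. \<forall>b \<in> carrier A. P [a, b])"
  "(\<forall>xs \<in> args A Comp. P xs) \<longleftrightarrow> (\<forall>a \<in> carrier A. \<forall>b \<in> carrier A. P [a, b])"
  "(\<forall>xs \<in> args A Zero. P xs) \<longleftrightarrow> P []"
  by (auto simp: args_def numeral_2_eq_2 length_Suc_conv)

lemma ball_asym:
  "(\<forall>f \<in> F. P f) \<longleftrightarrow> (Join \<in> F \<longrightarrow> P Join) \<and> (Comp \<in> F \<longrightarrow> P Comp) \<and> (Zero \<in> F \<longrightarrow> P Zero)"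
  (is "?l \<longleftrightarrow> ?r")
proof
  assume r: ?r
  show ?l
  proof
    fix f assume "f \<in> F"
    then show "P f" using r by (cases f) simp_all
  qed
qed simp

definition preserves :: "csym set \<Rightarrow> 'a palg \<Rightarrow> (asym \<Rightarrow> 'b list \<Rightarrow> 'b option) \<Rightarrow> ('a \<Rightarrow> 'b) \<Rightarrow> bool" where
  "preserves \<sigma> A p \<theta> \<longleftrightarrow>
     (Join \<in> abstract_sym ` \<sigma> \<longrightarrow> (\<forall>a \<in> carrier A. \<forall>b \<in> carrier A.
        p Join [\<theta> a, \<theta> b] = map_option \<theta> (oper A Join [a, b]))) \<and>
     (Comp \<in> abstract_sym ` \<sigma> \<longrightarrow> (\<forall>a \<in> carrier A. \<forall>b \<in> carrier A.
        p Comp [\<theta> a, \<theta> b] = map_option \<theta> (oper A Comp [a, b]))) \<and>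
     (Zero \<in> abstract_sym ` \<sigma> \<longrightarrow> p Zero [] = map_option \<theta> (oper A Zero []))"

lemma preserves_iff:
  "preserves \<sigma> A p \<theta> \<longleftrightarrow>
     (\<forall>f \<in> abstract_sym ` \<sigma>. \<forall>xs \<in> args A f. p f (map \<theta> xs) = map_option \<theta> (oper A f xs))"
  unfolding ball_asym[of "abstract_sym ` \<sigma>"] ball_args preserves_def list.map by (rule refl)

lemma preserves_closed:
  assumes "partial_algebra \<sigma> A" "preserves \<sigma> A p \<theta>"
  shows "partial_algebra \<sigma> \<lparr>carrier = \<theta> ` carrier A, oper = p\<rparr>"
  unfolding partial_algebra_def
proof (intro ballI allI impI)
  fix f ys c
  assume f: "f \<in> abstract_sym ` \<sigma>" and ys: "ys \<in> args \<lparr>carrier = \<theta> ` carrier A, oper = p\<rparr> f"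
    and c: "oper \<lparr>carrier = \<theta> ` carrier A, oper = p\<rparr> f ys = Some c"
  from ys have "ys \<in> map \<theta> ` lists (carrier A)" "length ys = arity f"
    by (auto simp: args_def simp flip: lists_image)
  then obtain xs where "ys = map \<theta> xs" "xs \<in> lists (carrier A)" by (blast elim: imageE)
  with \<open>length ys = arity f\<close>
  have xs: "xs \<in> lists (carrier A)" "ys = map \<theta> xs" "length xs = arity f" by simp_all
  then have xs': "xs \<in> args A f" by (auto simp: args_def)
  then have "p f ys = map_option \<theta> (oper A f xs)"
    using assms(2) f xs unfolding preserves_iff by blast
  with c obtain d where "oper A f xs = Some d" "c = \<theta> d" by auto
  then show "c \<in> carrier \<lparr>carrier = \<theta> ` carrier A, oper = p\<rparr>"
    using assms(1) f xs' unfolding partial_algebra_def by auto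
qed

lemma set_representation_iff:
  "set_representation \<sigma> A \<theta> \<longleftrightarrow>
     partial_algebra \<sigma> A \<and> inj_on \<theta> (carrier A) \<and> preserves \<sigma> A set_oper \<theta>"
  (is "_ \<longleftrightarrow> ?r")
proof
  assume "set_representation \<sigma> A \<theta>"
  then show "?r"
    unfolding set_representation_def set_algebra_def isomorphism_def bij_betw_def set_palg_def
      preserves_iff palg.simps by (elim exE conjE) auto
next
  assume r: ?r
  then have "partial_algebra \<sigma> \<lparr>carrier = \<theta> ` carrier A, oper = set_oper\<rparr>"
    by (intro preserves_closed) simp_all
  then show "set_representation \<sigma> A \<theta>"
    using r unfolding set_representation_def set_algebra_def isomorphism_def bij_betw_def set_palg_def
      preserves_iff palg.simps by (intro exI[of _ "\<theta> ` carrier A"]) simp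
qed

lemma fun_representation_iff:
  "fun_representation \<sigma> A \<theta> \<longleftrightarrow>
     partial_algebra \<sigma> A \<and> inj_on \<theta> (carrier A) \<and> preserves \<sigma> A fun_oper \<theta> \<and>
     (\<forall>a \<in> carrier A. single_valued (\<theta> a))"
  (is "_ \<longleftrightarrow> ?r")
proof
  assume "fun_representation \<sigma> A \<theta>"
  then show "?r"
    unfolding fun_representation_def fun_algebra_def isomorphism_def bij_betw_def fun_palg_def
      preserves_iff palg.simps by (elim exE conjE) auto
next
  assume r: ?r
  then have "partial_algebra \<sigma> \<lparr>carrier = \<theta> ` carrier A, oper = fun_oper\<rparr>"
    by (intro preserves_closed) simp_all
  then show "fun_representation \<sigma> A \<theta>"
    using r unfolding fun_representation_def fun_algebra_def isomorphism_def bij_betw_def fun_palg_def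
      preserves_iff palg.simps by (intro exI[of _ "\<theta> ` carrier A"]) simp
qed

lemma completely_representable_setI:
  fixes \<theta> :: "'a \<Rightarrow> 'x set"
  assumes "DisjUnion \<in> \<sigma>" and rep: "set_representation \<sigma> A \<theta>" and compl: "lesssim_complete A \<theta>"
  shows "completely_representable \<sigma> A"
proof -
  define d where "d a b = (SOME x. x \<in> \<theta> a \<inter> \<theta> b)" for a b
  define n where "n a b = (SOME x. x \<in> \<theta> a - \<theta> b)" for a b
  define P :: "'a point \<Rightarrow> 'x" where
    "P = (\<lambda>(k, l). if k = 0 then d (l ! 0) (l ! 1) else n (l ! 0) (l ! 1))"
  define \<theta>' where "\<theta>' a = P -` \<theta> a" for a
  have d: "\<exists>q. P q \<in> \<theta> a \<inter> \<theta> b" if ne: "\<theta> a \<inter> \<theta> b \<noteq> {}" for a b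
  proof -
    have "d a b \<in> \<theta> a \<inter> \<theta> b" unfolding d_def by (rule someI_ex) (use ne in blast)
    moreover have "P (0, [a, b]) = d a b" by (simp add: P_def)
    ultimately show ?thesis by metis
  qed
  have n: "\<exists>q. P q \<in> \<theta> a - \<theta> b" if ne: "\<not> \<theta> a \<subseteq> \<theta> b" for a b
  proof -
    have "n a b \<in> \<theta> a - \<theta> b" unfolding n_def by (rule someI_ex) (use ne in blast)
    moreover have "P (1, [a, b]) = n a b" by (simp add: P_def)
    ultimately show ?thesis by metis
  qed
  have r: "partial_algebra \<sigma> A" "inj_on \<theta> (carrier A)" "preserves \<sigma> A set_oper \<theta>"
    using rep by (auto simp: set_representation_iff)
  have sub: "\<theta> a \<subseteq> \<theta> b" if "\<theta>' a = \<theta>' b" for a b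
    using n[of a b] that unfolding \<theta>'_def by blast
  have inj: "inj_on \<theta>' (carrier A)"
    using r(2) sub by (intro inj_onI) (rule inj_onD[OF r(2)], rule subset_antisym, simp_all)
  have disj: "\<theta>' a \<inter> \<theta>' b = {} \<longleftrightarrow> \<theta> a \<inter> \<theta> b = {}" for a b
    using d[of a b] unfolding \<theta>'_def by blast
  have un: "\<theta>' c = \<theta>' a \<union> \<theta>' b" if "\<theta> c = \<theta> a \<union> \<theta> b" for a b c
    using that unfolding \<theta>'_def by blast
  have resp: "preserves \<sigma> A set_oper \<theta>'"
    unfolding preserves_def
  proof (intro conjI impI ballI)
    fix a b assume "Join \<in> abstract_sym ` \<sigma>" "a \<in> carrier A" "b \<in> carrier A"
    then have "set_oper Join [\<theta> a, \<theta> b] = map_option \<theta> (oper A Join [a, b])"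
      using r(3) unfolding preserves_def by blast
    then show "set_oper Join [\<theta>' a, \<theta>' b] = map_option \<theta>' (oper A Join [a, b])"
      using disj[of a b] un[of _ a b] by (cases "oper A Join [a, b]") (auto split: if_splits)
  next
    fix a b assume "Comp \<in> abstract_sym ` \<sigma>" "a \<in> carrier A" "b \<in> carrier A"
    then have "set_oper Comp [\<theta> a, \<theta> b] = map_option \<theta> (oper A Comp [a, b])"
      using r(3) unfolding preserves_def by blast
    then show "set_oper Comp [\<theta>' a, \<theta>' b] = map_option \<theta>' (oper A Comp [a, b])"
      by simp
  next
    assume "Zero \<in> abstract_sym ` \<sigma>"
    then have "set_oper Zero [] = map_option \<theta> (oper A Zero [])"
      using r(3) unfolding preserves_def by blast
    then show "set_oper Zero [] = map_option \<theta>' (oper A Zero [])"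
      by (cases "oper A Zero []") (auto simp: \<theta>'_def)
  qed
  have "lesssim_complete A \<theta>'"
    unfolding lesssim_complete_def
  proof (intro allI impI)
    fix S a assume "S \<subseteq> carrier A \<and> pairwise_combinable A S \<and> is_supremum A S a"
    then have "\<theta> a = (\<Union>s \<in> S. \<theta> s)" using compl unfolding lesssim_complete_def by blast
    then show "\<theta>' a = (\<Union>s \<in> S. \<theta>' s)" unfolding \<theta>'_def by blast
  qed
  moreover have "set_representation \<sigma> A \<theta>'"
    unfolding set_representation_iff using r(1) inj resp by simp
  ultimately show ?thesis
    unfolding completely_representable_def using assms(1) by (intro disjI1 conjI exI)
qed

lemma completely_representable_funI:
  fixes \<theta> :: "'a \<Rightarrow> ('x \<times> 'x) set"
  assumes "DomDisjUnion \<in> \<sigma>" and rep: "fun_representation \<sigma> A \<theta>" and compl: "lesssim_complete A \<theta>"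
  shows "completely_representable \<sigma> A"
proof -
  have r: "partial_algebra \<sigma> A" "inj_on \<theta> (carrier A)" "preserves \<sigma> A fun_oper \<theta>"
    and sv: "\<And>a. a \<in> carrier A \<Longrightarrow> single_valued (\<theta> a)"
    using rep by (auto simp: fun_representation_iff)
  define d where "d a b = (SOME x. x \<in> Domain (\<theta> a) \<inter> Domain (\<theta> b))" for a b
  define n where "n a b = (SOME x. \<exists>y. (x, y) \<in> \<theta> a - \<theta> b)" for a b
  define go where "go = foldl (\<lambda>x a. SOME y. (x, y) \<in> \<theta> a)"
  define P :: "'a point \<Rightarrow> 'x" where
    "P = (\<lambda>(k, l). go (if k = 0 then d (l ! 0) (l ! 1) else n (l ! 0) (l ! 1)) (drop 2 l))"
  obtain Q where Q: "inj_on P Q" "P ` Q = P ` {(k, l). 2 \<le> length l}"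
    using subset_image_inj[of "P ` {(k, l). 2 \<le> length l}" P "{(k, l). 2 \<le> length l}"] by auto
  define \<theta>' where "\<theta>' a = {(q, r). q \<in> Q \<and> r \<in> Q \<and> (P q, P r) \<in> \<theta> a}" for a
  have fwd: "\<exists>r \<in> Q. P r = y" if q: "q \<in> Q" and a: "a \<in> carrier A" and qy: "(P q, y) \<in> \<theta> a" for q a y
  proof -
    obtain k l where kl: "2 \<le> length l" "P q = P (k, l)"
    proof -
      have "P q \<in> P ` {(k, l). 2 \<le> length l}" using q unfolding Q(2)[symmetric] by (rule imageI)
      then show ?thesis using that by auto
    qed
    have "(SOME y. (P q, y) \<in> \<theta> a) = y"
      using qy by (rule some_equality) (rule single_valuedD[OF sv[OF a] _ qy])
    moreover have "P (k, l @ [a]) = (SOME y. (P (k, l), y) \<in> \<theta> a)"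
    proof -
      have "0 < length l" "1 < length l" using kl(1) by linarith+
      then have "(l @ [a]) ! 0 = l ! 0" "(l @ [a]) ! 1 = l ! 1" by (simp_all only: nth_append if_True)
      moreover have "drop 2 (l @ [a]) = drop 2 l @ [a]" using kl(1) by simp
      ultimately show ?thesis by (simp only: P_def go_def prod.case foldl_append foldl.simps)
    qed
    ultimately have "P (k, l @ [a]) = y" using kl(2) by simp
    moreover have "(k, l @ [a]) \<in> {(k, l). 2 \<le> length l}" using kl(1) by simp
    ultimately have "y \<in> P ` Q" unfolding Q(2) by (rule image_eqI[OF sym])
    then show ?thesis by auto
  qed
  have start: "go (if k = 0 then d a b else n a b) [] \<in> P ` Q" for k :: nat and a b
  proof -
    have "P (k, [a, b]) = go (if k = 0 then d a b else n a b) []" by (simp add: P_def)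
    moreover have "(k, [a, b]) \<in> {(k, l). 2 \<le> length l}" by simp
    ultimately show ?thesis unfolding Q(2) by (rule image_eqI[OF sym])
  qed
  have dQ: "d a b \<in> P ` Q" and nQ: "n a b \<in> P ` Q" for a b
    using start[of 0 a b] start[of 1 a b] by (simp_all add: go_def)
  have dom: "Domain (\<theta>' a) = {q \<in> Q. P q \<in> Domain (\<theta> a)}" if a: "a \<in> carrier A" for a
  proof (intro equalityI subsetI)
    fix q assume "q \<in> {q \<in> Q. P q \<in> Domain (\<theta> a)}"
    then obtain y where q: "q \<in> Q" "(P q, y) \<in> \<theta> a" by auto
    then obtain r where "r \<in> Q" "P r = y" using fwd[OF q(1) a q(2)] by (elim bexE)
    then have "(q, r) \<in> \<theta>' a" using q by (simp add: \<theta>'_def)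
    then show "q \<in> Domain (\<theta>' a)" by (rule DomainI)
  qed (auto simp: \<theta>'_def)
  have disj: "Domain (\<theta>' a) \<inter> Domain (\<theta>' b) = {} \<longleftrightarrow> Domain (\<theta> a) \<inter> Domain (\<theta> b) = {}"
    if "a \<in> carrier A" "b \<in> carrier A" for a b
  proof
    assume *: "Domain (\<theta>' a) \<inter> Domain (\<theta>' b) = {}"
    show "Domain (\<theta> a) \<inter> Domain (\<theta> b) = {}"
    proof (rule ccontr)
      assume "Domain (\<theta> a) \<inter> Domain (\<theta> b) \<noteq> {}"
      then have "d a b \<in> Domain (\<theta> a) \<inter> Domain (\<theta> b)"
        unfolding d_def ex_in_conv[symmetric] by (rule someI_ex)
      moreover obtain q where "q \<in> Q" "P q = d a b" using dQ[of a b] by (metis imageE)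
      ultimately have "q \<in> Domain (\<theta>' a) \<inter> Domain (\<theta>' b)"
        unfolding dom[OF that(1)] dom[OF that(2)] by simp
      with * show False by simp
    qed
  next
    assume "Domain (\<theta> a) \<inter> Domain (\<theta> b) = {}"
    then show "Domain (\<theta>' a) \<inter> Domain (\<theta>' b) = {}"
      unfolding dom[OF that(1)] dom[OF that(2)] by (simp add: disjoint_iff)
  qed
  have sub: "\<theta> a \<subseteq> \<theta> b" if eq: "\<theta>' a = \<theta>' b" and a: "a \<in> carrier A" for a b
  proof (rule ccontr)
    assume "\<not> \<theta> a \<subseteq> \<theta> b"
    then have "\<exists>x y. (x, y) \<in> \<theta> a - \<theta> b" by auto
    then have "\<exists>y. (n a b, y) \<in> \<theta> a - \<theta> b" unfolding n_def by (rule someI_ex)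
    then obtain y where y: "(n a b, y) \<in> \<theta> a" "(n a b, y) \<notin> \<theta> b" by blast
    obtain q where q: "q \<in> Q" "P q = n a b" using nQ[of a b] by (metis imageE)
    obtain r where "r \<in> Q" "P r = y" using fwd[OF q(1) a, of y] y(1) q(2) by fastforce
    then have "(q, r) \<in> \<theta>' a" "(q, r) \<notin> \<theta>' b" using q y by (auto simp: \<theta>'_def)
    with eq show False by blast
  qed
  have inj: "inj_on \<theta>' (carrier A)"
    using r(2) sub by (intro inj_onI) (rule inj_onD[OF r(2)], rule subset_antisym, simp_all)
  have sv': "single_valued (\<theta>' a)" if "a \<in> carrier A" for a
  proof (rule single_valuedI)
    fix q r s assume "(q, r) \<in> \<theta>' a" "(q, s) \<in> \<theta>' a"
    then have *: "r \<in> Q" "s \<in> Q" "(P q, P r) \<in> \<theta> a" "(P q, P s) \<in> \<theta> a"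
      by (auto simp: \<theta>'_def)
    then have "P r = P s" using single_valuedD[OF sv[OF that]] by blast
    then show "r = s" using inj_onD[OF Q(1)] *(1,2) by blast
  qed
  have un: "\<theta>' c = \<theta>' a \<union> \<theta>' b" if "\<theta> c = \<theta> a \<union> \<theta> b" for a b c
    using that unfolding \<theta>'_def by blast
  have resp: "preserves \<sigma> A fun_oper \<theta>'"
    unfolding preserves_def
  proof (intro conjI impI ballI)
    fix a b assume *: "Join \<in> abstract_sym ` \<sigma>" "a \<in> carrier A" "b \<in> carrier A"
    then have "fun_oper Join [\<theta> a, \<theta> b] = map_option \<theta> (oper A Join [a, b])"
      using r(3) unfolding preserves_def by blast
    then show "fun_oper Join [\<theta>' a, \<theta>' b] = map_option \<theta>' (oper A Join [a, b])"
      using disj[OF *(2,3)] un[of _ a b] by (cases "oper A Join [a, b]") (auto split: if_splits)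
  next
    fix a b assume *: "Comp \<in> abstract_sym ` \<sigma>" "a \<in> carrier A" "b \<in> carrier A"
    then have "fun_oper Comp [\<theta> a, \<theta> b] = map_option \<theta> (oper A Comp [a, b])"
      using r(3) unfolding preserves_def by blast
    then obtain c where c: "oper A Comp [a, b] = Some c" "\<theta> c = \<theta> a O \<theta> b"
      by (cases "oper A Comp [a, b]") auto
    have "\<theta>' c = \<theta>' a O \<theta>' b"
    proof (intro equalityI subsetI)
      fix p assume "p \<in> \<theta>' c"
      then obtain q s where p: "p = (q, s)" "q \<in> Q" "s \<in> Q" and "(P q, P s) \<in> \<theta> c"
        unfolding \<theta>'_def by blast
      then have "(P q, P s) \<in> \<theta> a O \<theta> b" using c(2) by simp
      then obtain y where y: "(P q, y) \<in> \<theta> a" "(y, P s) \<in> \<theta> b" by blast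
      then obtain t where "t \<in> Q" "P t = y" using fwd[OF p(2) *(2) y(1)] by (elim bexE)
      then have "(q, t) \<in> \<theta>' a" "(t, s) \<in> \<theta>' b" using p y by (simp_all add: \<theta>'_def)
      then show "p \<in> \<theta>' a O \<theta>' b" unfolding p(1) by (rule relcompI)
    next
      fix p assume "p \<in> \<theta>' a O \<theta>' b"
      then obtain q t s where "p = (q, s)" "(q, t) \<in> \<theta>' a" "(t, s) \<in> \<theta>' b"
        by (rule relcompE)
      then show "p \<in> \<theta>' c" using relcompI[of "P q" "P t" "\<theta> a" "P s" "\<theta> b"]
        unfolding \<theta>'_def c(2) by simp
    qed
    then show "fun_oper Comp [\<theta>' a, \<theta>' b] = map_option \<theta>' (oper A Comp [a, b])"
      using c(1) by simp
  next
    assume "Zero \<in> abstract_sym ` \<sigma>"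
    then have "fun_oper Zero [] = map_option \<theta> (oper A Zero [])"
      using r(3) unfolding preserves_def by blast
    then show "fun_oper Zero [] = map_option \<theta>' (oper A Zero [])"
      by (cases "oper A Zero []") (auto simp: \<theta>'_def)
  qed
  have "lesssim_complete A \<theta>'"
    unfolding lesssim_complete_def
  proof (intro allI impI)
    fix S a assume "S \<subseteq> carrier A \<and> pairwise_combinable A S \<and> is_supremum A S a"
    then have "\<theta> a = (\<Union>s \<in> S. \<theta> s)" using compl unfolding lesssim_complete_def by blast
    then show "\<theta>' a = (\<Union>s \<in> S. \<theta>' s)" unfolding \<theta>'_def by blast
  qed
  moreover have "fun_representation \<sigma> A \<theta>'"
    unfolding fun_representation_iff using r(1) inj resp sv' by simp
  ultimately show ?thesis
    unfolding completely_representable_def using assms(1) by (intro disjI2 conjI exI)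
qed

end

(*
  Let D_n be disjoint sets of 2n points and let A consist of the finite sets that meet every D_n in
  an even number of points. All elements of A being finite, every pairwise combinable set with a
  supremum is finite and its supremum is its union, so A is completely representable; B is an
  ultrapower of A. The hyperfinite block t of B has an external matching S into pairs that leaves
  out exactly one point 0: skip 0 and shift the pairing by one below the standard cut only. An
  internal upper bound of S contains t, since it misses an even number of points of t; thus t is
  the supremum of S. In a complete representation, however, a common point of the incombinable
  pairs {0,1} and {0,3} lies in t but in no member of S, because each member of S is combinable
  with one of the two.
*)

theory Submission
  imports Defs "HOL-Library.Nat_Bijection"
begin

section \<open>Ultrafilters and ultrapowers\<close>

text \<open>Smaller filters have more large sets, so ultrafilters are the minimal proper filters.
  Zorn's lemma is therefore applied to the reversed order below \<open>F\<close>.\<close>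

lemma ultrafilter_exists:
  assumes "F \<noteq> bot"
  shows "\<exists>U. U \<noteq> bot \<and> U \<le> F \<and> (\<forall>P. eventually P U \<or> eventually (\<lambda>x. \<not> P x) U)"
proof -
  define N where "N = {G. G \<noteq> bot \<and> G \<le> F}"
  have "\<exists>m\<in>N. \<forall>a\<in>N. m \<ge> a \<longrightarrow> a = m"
  proof (rule predicate_Zorn)
    show "partial_order_on N (relation_of (\<ge>) N)"
      by (rule partial_order_on_relation_ofI) auto
    fix C assume C: "C \<in> Chains (relation_of (\<ge>) N)"
    show "\<exists>u\<in>N. \<forall>a\<in>C. u \<le> a"
    proof (cases "C = {}")
      case True
      then show ?thesis using assms by (auto simp: N_def)
    next
      case False
      have CN: "C \<subseteq> N" using C by (auto simp: Chains_def relation_of_def)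
      have base: "\<exists>x\<in>C. x \<le> inf G H" if "G \<in> C" "H \<in> C" for G H
      proof -
        have "G \<le> H \<or> H \<le> G" using C that unfolding Chains_def relation_of_def by blast
        then show ?thesis using that by (auto simp: inf_absorb1 inf_absorb2)
      qed
      \<comment> \<open>A chain is directed, so a set is large for \<open>Inf C\<close> iff it is
        large for a single member; hence the infimum of proper filters stays proper.\<close>
      have "eventually P (Inf C) \<longleftrightarrow> (\<exists>G\<in>C. eventually P G)" for P
        by (rule eventually_Inf_base[OF False base])
      then have "Inf C \<noteq> bot"
        using CN unfolding N_def trivial_limit_def by blast
      moreover have "Inf C \<le> F"
      proof -
        obtain G where "G \<in> C" using False by blast
        then show ?thesis using CN Inf_lower[of G C] by (auto simp: N_def)
      qed
      ultimately have "Inf C \<in> N" by (simp add: N_def)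
      then show ?thesis by (auto intro: Inf_lower)
    qed
  qed
  then obtain U where U: "U \<in> N" "\<And>G. G \<in> N \<Longrightarrow> G \<le> U \<Longrightarrow> G = U" by blast
  have "eventually P U \<or> eventually (\<lambda>x. \<not> P x) U" for P
  \<comment> \<open>Restricting \<open>U\<close> to \<open>P\<close> gives a smaller filter: it is
    either improper, and then the complement of \<open>P\<close> is large, or equal to
    \<open>U\<close> by minimality.\<close>
  proof (cases "inf U (principal {x. P x}) = bot")
    case True
    then have "eventually (\<lambda>x. \<not> P x) U"
      by (simp add: trivial_limit_def eventually_inf_principal)
    then show ?thesis ..
  next
    case False
    then have "inf U (principal {x. P x}) = U"
      using U by (auto simp: N_def intro: le_infI1)
    moreover have "eventually P (inf U (principal {x. P x}))"
      by (simp add: eventually_inf_principal)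
    ultimately show ?thesis by simp
  qed
  then show ?thesis using U(1) by (auto simp: N_def)
qed

lemma tm_val_in:
  assumes "fo_structure \<sigma> B" "\<And>k. e k \<in> carrier B" "tm_syms t \<subseteq> abstract_sym ` \<sigma>"
  shows "tm_val B e t \<in> carrier B"
  using assms(3)
proof (induction t)
  case (Cmp t u)
  then have xs: "[tm_val B e t, tm_val B e u] \<in> args B Comp" and s: "Comp \<in> abstract_sym ` \<sigma> - {Join}"
    by (auto simp: args_def)
  then obtain c where c: "oper B Comp [tm_val B e t, tm_val B e u] = Some c"
    using assms(1) unfolding fo_structure_def by blast
  then have "c \<in> carrier B" using assms(1) xs s unfolding fo_structure_def partial_algebra_def by blast
  then show ?case using c by simp
next
  case Zer
  then have xs: "[] \<in> args B Zero" and s: "Zero \<in> abstract_sym ` \<sigma> - {Join}"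
    by (auto simp: args_def)
  then obtain c where c: "oper B Zero [] = Some c"
    using assms(1) unfolding fo_structure_def by blast
  then have "c \<in> carrier B" using assms(1) xs s unfolding fo_structure_def partial_algebra_def by blast
  then show ?case using c by simp
qed (simp add: assms(2))

text \<open>
  Since the elements of an ultrapower are equivalence classes of sequences, the map \<open>h\<close> is used to
  name a chosen representative of each class by an element of the target type.
\<close>

locale ultrapower =
  fixes U :: "'i filter" and \<sigma> :: "csym set" and A :: "'a palg" and h :: "('i \<Rightarrow> 'a) \<Rightarrow> 'b"
  assumes proper: "U \<noteq> bot"
    and ultra: "\<And>P. eventually P U \<or> eventually (\<lambda>i. \<not> P i) U"
    and struct: "fo_structure \<sigma> A"
    and inj_h: "inj_on h {f. \<forall>i. f i \<in> carrier A}"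
begin

definition seqs :: "('i \<Rightarrow> 'a) set" where
  "seqs = {f. \<forall>i. f i \<in> carrier A}"

text \<open>The predicate under \<open>SOME\<close> depends only on the class of \<open>f\<close>
  modulo \<open>U\<close>. The chosen representative has all its values in the carrier, even if
  \<open>f\<close> has this only almost everywhere.\<close>

definition cls :: "('i \<Rightarrow> 'a) \<Rightarrow> 'b" where
  "cls f = h (SOME g. g \<in> seqs \<and> (\<forall>\<^sub>F i in U. g i = f i))"

definition un :: "'b \<Rightarrow> 'i \<Rightarrow> 'a" where
  "un = inv_into seqs h"

text \<open>An operation is defined iff it is defined in almost every coordinate. In the exceptional
  coordinates \<open>the\<close> returns an arbitrary value, which \<open>cls\<close>
  ignores.\<close>

definition upower :: "'b palg" where
  "upower = \<lparr>carrier = cls ` seqs,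
     oper = (\<lambda>s xs. if \<forall>\<^sub>F i in U. oper A s (map (\<lambda>x. un x i) xs) \<noteq> None
       then Some (cls (\<lambda>i. the (oper A s (map (\<lambda>x. un x i) xs)))) else None)\<rparr>"

lemma not_eventually: "\<not> eventually P U \<longleftrightarrow> eventually (\<lambda>i. \<not> P i) U"
proof
  assume "\<forall>\<^sub>F i in U. \<not> P i"
  then show "\<not> eventually P U"
    using eventually_conj[of P U "\<lambda>i. \<not> P i"] proper by (auto simp: trivial_limit_def)
qed (use ultra[of P] in blast)

lemma un_cls:
  assumes "\<forall>\<^sub>F i in U. f i \<in> carrier A"
  shows "un (cls f) \<in> seqs" "\<forall>\<^sub>F i in U. un (cls f) i = f i"
proof -
  obtain c where c: "c \<in> carrier A"
    using eventually_happens'[OF proper assms] by blast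
  \<comment> \<open>\<open>f\<close> is repaired on a null set by the fixed element
    \<open>c\<close>, which exists because \<open>U\<close> is proper.\<close>
  have "(\<lambda>i. if f i \<in> carrier A then f i else c) \<in> seqs" using c by (simp add: seqs_def)
  moreover have "\<forall>\<^sub>F i in U. (if f i \<in> carrier A then f i else c) = f i"
    using assms by (auto elim: eventually_mono)
  ultimately have ex: "\<exists>g. g \<in> seqs \<and> (\<forall>\<^sub>F i in U. g i = f i)"
    by (intro exI[of _ "\<lambda>i. if f i \<in> carrier A then f i else c"] conjI)
  define g where "g = (SOME g. g \<in> seqs \<and> (\<forall>\<^sub>F i in U. g i = f i))"
  have g: "g \<in> seqs \<and> (\<forall>\<^sub>F i in U. g i = f i)"
    unfolding g_def by (rule someI_ex[OF ex])
  then have "un (cls f) = g"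
    unfolding un_def cls_def g_def[symmetric] using inj_h by (intro inv_into_f_f) (auto simp: seqs_def)
  with g show "un (cls f) \<in> seqs" "\<forall>\<^sub>F i in U. un (cls f) i = f i" by simp_all
qed

lemma cls_cong:
  assumes "\<forall>\<^sub>F i in U. f i = g i"
  shows "cls f = cls g"
proof -
  have "(\<forall>\<^sub>F i in U. k i = f i) \<longleftrightarrow> (\<forall>\<^sub>F i in U. k i = g i)" for k
    using assms by (intro eventually_subst) (auto elim: eventually_mono)
  then show ?thesis by (simp add: cls_def)
qed

lemma cls_in_upower:
  assumes "\<forall>\<^sub>F i in U. f i \<in> carrier A"
  shows "cls f \<in> carrier upower"
proof -
  have "cls f = cls (un (cls f))"
    using un_cls(2)[OF assms] by (intro cls_cong) (auto elim: eventually_mono)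
  then show ?thesis using un_cls(1)[OF assms] by (auto simp: upower_def)
qed

lemma un_in:
  assumes "x \<in> carrier upower"
  shows "un x i \<in> carrier A"
proof -
  obtain f where "x = cls f" "f \<in> seqs" using assms by (auto simp: upower_def)
  then show ?thesis using un_cls(1)[of f] by (simp add: seqs_def)
qed

lemma cls_un:
  assumes "x \<in> carrier upower"
  shows "cls (un x) = x"
proof -
  obtain f where x: "x = cls f" and f: "f \<in> seqs" using assms by (auto simp: upower_def)
  have "cls (un (cls f)) = cls f"
    using f un_cls(2)[of f] by (intro cls_cong) (simp add: seqs_def)
  then show ?thesis using x by simp
qed

lemma upower_eq_iff:
  assumes "x \<in> carrier upower" "y \<in> carrier upower"
  shows "x = y \<longleftrightarrow> (\<forall>\<^sub>F i in U. un x i = un y i)"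
  using cls_cong[of "un x" "un y"] cls_un[OF assms(1)] cls_un[OF assms(2)] by auto

lemma oper_defined_iff:
  "oper upower s xs \<noteq> None \<longleftrightarrow> (\<forall>\<^sub>F i in U. oper A s (map (\<lambda>x. un x i) xs) \<noteq> None)"
  by (simp add: upower_def)

lemma args_un: "xs \<in> args upower s \<Longrightarrow> map (\<lambda>x. un x i) xs \<in> args A s"
  by (auto simp: args_def un_in)

lemma oper_closed:
  "s \<in> abstract_sym ` \<sigma> \<Longrightarrow> xs \<in> args A s \<Longrightarrow> oper A s xs = Some c \<Longrightarrow> c \<in> carrier A"
  using struct by (auto simp: fo_structure_def partial_algebra_def)

lemma oper_SomeD:
  assumes s: "s \<in> abstract_sym ` \<sigma>" and xs: "xs \<in> args upower s" and z: "oper upower s xs = Some z"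
  shows "z \<in> carrier upower" "\<forall>\<^sub>F i in U. oper A s (map (\<lambda>x. un x i) xs) = Some (un z i)"
proof -
  define f where "f = (\<lambda>i. the (oper A s (map (\<lambda>x. un x i) xs)))"
  have ev: "\<forall>\<^sub>F i in U. oper A s (map (\<lambda>x. un x i) xs) = Some (f i)" and zf: "z = cls f"
    using z by (auto simp: upower_def f_def split: if_splits elim!: eventually_mono)
  have f: "\<forall>\<^sub>F i in U. f i \<in> carrier A"
    using ev by (rule eventually_mono) (rule oper_closed[OF s args_un[OF xs]])
  show "z \<in> carrier upower" unfolding zf by (rule cls_in_upower[OF f])
  show "\<forall>\<^sub>F i in U. oper A s (map (\<lambda>x. un x i) xs) = Some (un z i)"
    using ev un_cls(2)[OF f] unfolding zf by eventually_elim simp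
qed

lemma oper_iff:
  assumes s: "s \<in> abstract_sym ` \<sigma>" and xs: "xs \<in> args upower s" and z: "z \<in> carrier upower"
  shows "oper upower s xs = Some z \<longleftrightarrow> (\<forall>\<^sub>F i in U. oper A s (map (\<lambda>x. un x i) xs) = Some (un z i))"
proof
  assume ev: "\<forall>\<^sub>F i in U. oper A s (map (\<lambda>x. un x i) xs) = Some (un z i)"
  then have "oper upower s xs \<noteq> None"
    unfolding oper_defined_iff by (rule eventually_mono) simp
  then obtain w where w: "oper upower s xs = Some w" by blast
  have "w = z"
    unfolding upower_eq_iff[OF oper_SomeD(1)[OF s xs w] z]
    using ev oper_SomeD(2)[OF s xs w] by eventually_elim simp
  then show "oper upower s xs = Some z" using w by simp
qed (rule oper_SomeD(2)[OF s xs])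

lemma fo_structure_upower: "fo_structure \<sigma> upower"
  unfolding fo_structure_def
proof (intro conjI ballI)
  show "partial_algebra \<sigma> upower"
    unfolding partial_algebra_def using oper_SomeD(1) by blast
next
  fix s xs assume "s \<in> abstract_sym ` \<sigma> - {Join}" "xs \<in> args upower s"
  then have "oper A s (map (\<lambda>x. un x i) xs) \<noteq> None" for i
    using struct args_un[of xs s i] by (auto simp: fo_structure_def)
  then show "oper upower s xs \<noteq> None"
    unfolding oper_defined_iff by (intro always_eventually allI)
qed

section \<open>Los's theorem\<close>

text \<open>Each function symbol costs one null set, since representatives agree with coordinatewise
  values only almost everywhere; a term contains finitely many.\<close>

lemma tm_val_upower:
  assumes e: "\<And>k. e k \<in> carrier upower" and "tm_syms t \<subseteq> abstract_sym ` \<sigma>"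
  shows "\<forall>\<^sub>F i in U. un (tm_val upower e t) i = tm_val A (\<lambda>k. un (e k) i) t"
  using assms(2)
proof (induction t)
  case (Cmp t u)
  let ?xs = "[tm_val upower e t, tm_val upower e u]"
  have xs: "?xs \<in> args upower Comp"
    using Cmp.prems tm_val_in[of \<sigma> upower e] fo_structure_upower e by (simp add: args_def)
  have s: "Comp \<in> abstract_sym ` \<sigma>" using Cmp.prems by auto
  then obtain c where c: "oper upower Comp ?xs = Some c"
    using fo_structure_upower xs unfolding fo_structure_def by blast
  have "\<forall>\<^sub>F i in U. un (tm_val upower e t) i = tm_val A (\<lambda>k. un (e k) i) t"
    "\<forall>\<^sub>F i in U. un (tm_val upower e u) i = tm_val A (\<lambda>k. un (e k) i) u"
    using Cmp by auto
  with oper_SomeD(2)[OF s xs c] show ?case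
    by eventually_elim (simp add: c)
next
  case Zer
  have xs: "[] \<in> args upower Zero" by (simp add: args_def)
  have s: "Zero \<in> abstract_sym ` \<sigma>" using Zer.prems by auto
  then obtain c where c: "oper upower Zero [] = Some c"
    using fo_structure_upower xs unfolding fo_structure_def by blast
  show ?case
    using oper_SomeD(2)[OF s xs c] by eventually_elim (simp add: c)
qed simp

text \<open>Atomic formulas reduce to term values and \<open>oper_iff\<close>, conjunction uses
  closure of filters under intersection, negation uses the ultrafilter property, and the quantifier
  uses choice.\<close>

theorem Los:
  assumes "\<And>k. e k \<in> carrier upower" "fm_syms p \<subseteq> abstract_sym ` \<sigma>"
  shows "sat upower e p \<longleftrightarrow> (\<forall>\<^sub>F i in U. sat A (\<lambda>k. un (e k) i) p)"
  using assms
proof (induction p arbitrary: e)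
  case (Eq t u)
  then have *: "tm_syms t \<subseteq> abstract_sym ` \<sigma>" "tm_syms u \<subseteq> abstract_sym ` \<sigma>" by auto
  have tv: "\<forall>\<^sub>F i in U. un (tm_val upower e t) i = tm_val A (\<lambda>k. un (e k) i) t"
    if "tm_syms t \<subseteq> abstract_sym ` \<sigma>" for t
    using Eq.prems(1) that by (rule tm_val_upower)
  have in_B: "tm_val upower e t \<in> carrier upower" if "tm_syms t \<subseteq> abstract_sym ` \<sigma>" for t
    using fo_structure_upower Eq.prems(1) that by (rule tm_val_in)
  have "sat upower e (Eq t u) \<longleftrightarrow> (\<forall>\<^sub>F i in U. un (tm_val upower e t) i = un (tm_val upower e u) i)"
    using in_B[OF *(1)] in_B[OF *(2)] by (simp add: upower_eq_iff)
  also have "\<dots> \<longleftrightarrow> (\<forall>\<^sub>F i in U. sat A (\<lambda>k. un (e k) i) (Eq t u))"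
    using tv[OF *(1)] tv[OF *(2)]
    by (rule eventually_subst[OF eventually_elim2]) simp
  finally show ?case .
next
  case (J t u v)
  then have *: "tm_syms t \<subseteq> abstract_sym ` \<sigma>" "tm_syms u \<subseteq> abstract_sym ` \<sigma>"
    "tm_syms v \<subseteq> abstract_sym ` \<sigma>" and s: "Join \<in> abstract_sym ` \<sigma>" by auto
  have tv: "\<forall>\<^sub>F i in U. un (tm_val upower e t) i = tm_val A (\<lambda>k. un (e k) i) t"
    if "tm_syms t \<subseteq> abstract_sym ` \<sigma>" for t
    using J.prems(1) that by (rule tm_val_upower)
  have in_B: "tm_val upower e t \<in> carrier upower" if "tm_syms t \<subseteq> abstract_sym ` \<sigma>" for t
    using fo_structure_upower J.prems(1) that by (rule tm_val_in)
  have "sat upower e (J t u v) \<longleftrightarrow> (\<forall>\<^sub>F i in U.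
      oper A Join [un (tm_val upower e t) i, un (tm_val upower e u) i] = Some (un (tm_val upower e v) i))"
    using oper_iff[OF s, of "[tm_val upower e t, tm_val upower e u]"]
      in_B[OF *(1)] in_B[OF *(2)] in_B[OF *(3)] by (simp add: args_def)
  also have "\<dots> \<longleftrightarrow> (\<forall>\<^sub>F i in U. sat A (\<lambda>k. un (e k) i) (J t u v))"
    using eventually_conj[OF tv[OF *(1)] tv[OF *(2)]] tv[OF *(3)]
    by (rule eventually_subst[OF eventually_elim2]) simp
  finally show ?case .
next
  case (Neg p)
  then show ?case by (simp add: not_eventually)
next
  case (Conj p q)
  then show ?case by (simp add: eventually_conj_iff)
next
  case (Ex n p)
  have IH: "sat upower (e(n := b)) p \<longleftrightarrow> (\<forall>\<^sub>F i in U. sat A ((\<lambda>k. un (e k) i)(n := un b i)) p)"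
    if "b \<in> carrier upower" for b
  proof -
    have "sat upower (e(n := b)) p \<longleftrightarrow> (\<forall>\<^sub>F i in U. sat A (\<lambda>k. un ((e(n := b)) k) i) p)"
      using Ex.prems that by (intro Ex.IH) auto
    moreover have "(\<lambda>k. un ((e(n := b)) k) i) = (\<lambda>k. un (e k) i)(n := un b i)" for i by auto
    ultimately show ?thesis by simp
  qed
  show ?case
  proof
    assume "sat upower e (Ex n p)"
    then obtain b where "b \<in> carrier upower" "sat upower (e(n := b)) p" by auto
    then show "\<forall>\<^sub>F i in U. sat A (\<lambda>k. un (e k) i) (Ex n p)"
      using IH[of b] un_in[of b] by (auto elim!: eventually_mono)
  next
    \<comment> \<open>Witnesses are chosen coordinatewise; \<open>cls f\<close> is then a single
      witness in the ultrapower.\<close>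
    define f where "f i = (SOME a. a \<in> carrier A \<and> sat A ((\<lambda>k. un (e k) i)(n := a)) p)" for i
    assume "\<forall>\<^sub>F i in U. sat A (\<lambda>k. un (e k) i) (Ex n p)"
    then have ev: "\<forall>\<^sub>F i in U. f i \<in> carrier A \<and> sat A ((\<lambda>k. un (e k) i)(n := f i)) p"
      by (rule eventually_mono) (unfold f_def, rule someI_ex, auto)
    then have f: "\<forall>\<^sub>F i in U. f i \<in> carrier A" by (rule eventually_mono) simp
    have "\<forall>\<^sub>F i in U. sat A ((\<lambda>k. un (e k) i)(n := un (cls f) i)) p"
      using ev un_cls(2)[OF f] by eventually_elim simp
    then show "sat upower e (Ex n p)"
      using IH cls_in_upower[OF f] by auto
  qed
qed

text \<open>The truth of a sentence in \<open>A\<close> is the same in every coordinate, so holding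
  almost everywhere means holding. The class of a constant sequence supplies the environment in the
  carrier that \<open>Los\<close> requires.\<close>

lemma elementarily_equivalent_upower:
  assumes "carrier A \<noteq> {}"
  shows "elementarily_equivalent \<sigma> A upower"
  unfolding elementarily_equivalent_def
proof (intro conjI allI impI)
  fix p assume p: "sentence \<sigma> p"
  obtain a where a: "a \<in> carrier A" using assms by blast
  define b where "b = cls (\<lambda>_. a)"
  have b: "b \<in> carrier upower" unfolding b_def by (rule cls_in_upower) (simp add: a)
  have "models upower p \<longleftrightarrow> sat upower (\<lambda>_. b) p" by (rule models_sentence[OF p])
  also have "\<dots> \<longleftrightarrow> (\<forall>\<^sub>F i in U. sat A (\<lambda>_. un b i) p)"
    using b p unfolding sentence_def by (intro Los) auto
  also have "\<dots> \<longleftrightarrow> (\<forall>\<^sub>F i in U. models A p)"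
    unfolding models_sentence[OF p, symmetric] ..
  also have "\<dots> \<longleftrightarrow> models A p" using proper by (simp add: eventually_const_iff)
  finally show "models A p \<longleftrightarrow> models upower p" ..
qed (rule struct, rule fo_structure_upower)

end

section \<open>Evenness on blocks\<close>

text \<open>Composition is interpreted by partial functions whose composites are all empty.\<close>

definition even_palg :: "('i \<Rightarrow> 'a set) \<Rightarrow> 'a set palg" where
  "even_palg D = \<lparr>carrier = {a. finite a \<and> (\<forall>i. even (card (a \<inter> D i)))},
     oper = (\<lambda>s xs. if s = Comp then Some {} else set_oper s xs)\<rparr>"

lemma even_palg_carrier:
  "a \<in> carrier (even_palg D) \<longleftrightarrow> finite a \<and> (\<forall>i. even (card (a \<inter> D i)))"
  by (simp add: even_palg_def)

lemma even_palg_Join: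
  "oper (even_palg D) Join [a, b] = (if a \<inter> b = {} then Some (a \<union> b) else None)"
  by (simp add: even_palg_def)

lemma even_palg_Diff:
  assumes "a \<in> carrier (even_palg D)" "b \<in> carrier (even_palg D)" "a \<subseteq> b"
  shows "b - a \<in> carrier (even_palg D)"
proof -
  have "card ((b - a) \<inter> D i) = card (b \<inter> D i) - card (a \<inter> D i)" for i
  proof -
    have "(b - a) \<inter> D i = b \<inter> D i - a \<inter> D i" by blast
    then show ?thesis using assms by (auto simp: even_palg_carrier intro: card_Diff_subset)
  qed
  then show ?thesis using assms by (simp add: even_palg_carrier)
qed

lemma even_palg_Union:
  assumes "S \<subseteq> carrier (even_palg D)" "finite S" "pairwise disjnt S"
  shows "\<Union>S \<in> carrier (even_palg D)"
  using assms(2,1,3)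
proof (induction S rule: finite_induct)
  case (insert a S)
  have "card ((a \<union> \<Union>S) \<inter> D i) = card (a \<inter> D i) + card (\<Union>S \<inter> D i)" for i
  proof -
    have "a \<inter> \<Union>S = {}" using insert.hyps(2) insert.prems(2) by (auto simp: pairwise_def disjnt_def)
    then have "(a \<inter> D i) \<inter> (\<Union>S \<inter> D i) = {}" by blast
    then show ?thesis
      using insert
      by (auto simp: Int_Un_distrib2 even_palg_carrier pairwise_insert intro!: card_Un_disjoint)
  qed
  then show ?case using insert by (auto simp: even_palg_carrier pairwise_def disjnt_def)
qed (simp add: even_palg_carrier)

text \<open>The complement \<open>b - a\<close> is again even on every block, so it is the required
  summand.\<close>

lemma even_palg_lesssim:
  assumes "a \<in> carrier (even_palg D)" "b \<in> carrier (even_palg D)"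
  shows "lesssim (even_palg D) a b \<longleftrightarrow> a \<subseteq> b"
proof
  assume "a \<subseteq> b"
  then have "oper (even_palg D) Join [a, b - a] = Some b" by (auto simp: even_palg_Join)
  then show "lesssim (even_palg D) a b"
    unfolding lesssim_def using even_palg_Diff[OF assms \<open>a \<subseteq> b\<close>] by blast
qed (auto simp: lesssim_def even_palg_Join split: if_splits)

lemma fo_structure_even_palg: "fo_structure \<sigma> (even_palg D)"
proof -
  have "a \<union> b \<in> carrier (even_palg D)"
    if "a \<in> carrier (even_palg D)" "b \<in> carrier (even_palg D)" "a \<inter> b = {}" for a b
    using even_palg_Union[of "{a, b}" D] that by (auto simp: pairwise_def disjnt_def)
  moreover have "{} \<in> carrier (even_palg D)" by (simp add: even_palg_carrier)
  ultimately show ?thesis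
    unfolding fo_structure_def partial_algebra_def
    unfolding ball_asym[of "abstract_sym ` \<sigma>"] ball_asym[of "abstract_sym ` \<sigma> - {Join}"] ball_args
    by (auto simp: even_palg_Join) (auto simp: even_palg_def)
qed

text \<open>The members of \<open>S\<close> are subsets of the finite set \<open>a\<close>, so
  \<open>S\<close> is finite. Its disjoint union then lies in the algebra and is itself an upper
  bound.\<close>

lemma even_palg_supremum:
  assumes S: "S \<subseteq> carrier (even_palg D)" and comb: "pairwise_combinable (even_palg D) S"
    and sup: "is_supremum (even_palg D) S a"
  shows "a = \<Union>S"
proof -
  have a: "a \<in> carrier (even_palg D)" using sup by (simp add: is_supremum_def)
  have "s \<subseteq> a" if "s \<in> S" for s
    using sup S that even_palg_lesssim[OF _ a] by (auto simp: is_supremum_def)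
  then have sub: "\<Union>S \<subseteq> a" by blast
  have "finite S"
    by (rule finite_UnionD) (use a sub in \<open>auto simp: even_palg_carrier intro: finite_subset\<close>)
  moreover have "pairwise disjnt S"
    using comb by (auto simp: pairwise_combinable_def pairwise_def disjnt_def even_palg_Join split: if_splits)
  ultimately have U: "\<Union>S \<in> carrier (even_palg D)" using S by (intro even_palg_Union)
  then have "lesssim (even_palg D) s (\<Union>S)" if "s \<in> S" for s
    using S that by (subst even_palg_lesssim) auto
  then have "lesssim (even_palg D) a (\<Union>S)" using sup U by (simp add: is_supremum_def)
  then show ?thesis using even_palg_lesssim[OF a U] sub by blast
qed

lemma completely_representable_even_palg:
  assumes "DisjUnion \<in> \<sigma> \<and> Composition \<notin> \<sigma> \<or> DomDisjUnion \<in> \<sigma>"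
  shows "completely_representable \<sigma> (even_palg D)"
proof -
  have pa: "partial_algebra \<sigma> (even_palg D)"
    using fo_structure_even_palg by (auto simp: fo_structure_def)
  show ?thesis
  proof (cases "DomDisjUnion \<in> \<sigma>")
    case True
    \<comment> \<open>All points of \<open>a\<close> are sent to the extra point
      \<open>None\<close>, which lies in no domain. So all composites are empty, as in
      \<open>even_palg\<close>, while domains copy the sets.\<close>
    define \<theta> :: "'a set \<Rightarrow> ('a option \<times> 'a option) set" where "\<theta> a = (Some ` a) \<times> {None}" for a
    have inj: "inj \<theta>" by (rule injI) (auto simp: \<theta>_def times_eq_iff inj_image_eq_iff)
    have "preserves \<sigma> (even_palg D) fun_oper \<theta>"
      by (auto simp: preserves_def even_palg_def \<theta>_def)
    moreover have "single_valued (\<theta> a)" for a by (auto simp: \<theta>_def single_valued_def)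
    ultimately have "fun_representation \<sigma> (even_palg D) \<theta>"
      unfolding fun_representation_iff using pa inj by (auto intro: inj_on_subset)
    moreover have "lesssim_complete (even_palg D) \<theta>"
      by (auto simp: lesssim_complete_def \<theta>_def dest!: even_palg_supremum)
    ultimately show ?thesis using True by (intro completely_representable_funI)
  next
    case False
    then have "Comp \<notin> abstract_sym ` \<sigma>"
      using assms by (auto elim: abstract_sym.elims[OF sym])
    then have "preserves \<sigma> (even_palg D) set_oper (\<lambda>a. a)"
      by (auto simp: preserves_def even_palg_def)
    then have "set_representation \<sigma> (even_palg D) (\<lambda>a. a)"
      unfolding set_representation_iff using pa by auto
    moreover have "lesssim_complete (even_palg D) (\<lambda>a. a)"
      by (auto simp: lesssim_complete_def dest!: even_palg_supremum)
    ultimately show ?thesis using False assms by (intro completely_representable_setI) auto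
  qed
qed

section \<open>An obstruction to complete representability\<close>

text \<open>
  A representation needs a point common to \<open>a\<close> and \<open>b\<close>; it lies in \<open>t\<close> but in no member of \<open>S\<close>.
\<close>

lemma not_completely_representableI:
  assumes Join: "Join \<in> abstract_sym ` \<sigma>"
    and S: "S \<subseteq> carrier B" "pairwise_combinable B S" "is_supremum B S t"
    and a: "a \<in> carrier B" "lesssim B a t" and b: "b \<in> carrier B" "lesssim B b t"
    and ab: "oper B Join [a, b] = None"
    and avoid: "\<And>s. s \<in> S \<Longrightarrow> oper B Join [s, a] \<noteq> None \<or> oper B Join [s, b] \<noteq> None"
  shows "\<not> completely_representable \<sigma> B"
proof
  have t: "t \<in> carrier B" using S(3) by (simp add: is_supremum_def)
  \<comment> \<open>The final contradiction is stated for an arbitrary type of points, so that it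
    serves points of sets and pairs in graphs alike.\<close>
  have contra: False
    if compl: "lesssim_complete B \<theta>" and p: "p \<in> \<theta> t" "p \<in> \<theta> a" "p \<in> \<theta> b"
      and disj: "\<And>x y. x \<in> carrier B \<Longrightarrow> y \<in> carrier B \<Longrightarrow> oper B Join [x, y] \<noteq> None \<Longrightarrow> \<theta> x \<inter> \<theta> y = {}"
    for \<theta> :: "'a \<Rightarrow> 'c set" and p
  proof -
    have "\<theta> t = (\<Union>s\<in>S. \<theta> s)" using compl S unfolding lesssim_complete_def by blast
    then obtain s where s: "s \<in> S" "p \<in> \<theta> s" using p(1) by blast
    then have "s \<in> carrier B" using S(1) by blast
    then show False using avoid[OF s(1)] disj[of s a] disj[of s b] a(1) b(1) s(2) p(2,3) by blast
  qed
  assume "completely_representable \<sigma> B"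
  then consider
    (sets) \<theta> :: "'a \<Rightarrow> 'a point set" where "set_representation \<sigma> B \<theta>" "lesssim_complete B \<theta>"
  | (funs) \<theta> :: "'a \<Rightarrow> ('a point \<times> 'a point) set"
    where "fun_representation \<sigma> B \<theta>" "lesssim_complete B \<theta>"
    unfolding completely_representable_def by blast
  then show False
  proof cases
    case sets
    then have pr: "(if \<theta> x \<inter> \<theta> y = {} then Some (\<theta> x \<union> \<theta> y) else None)
        = map_option \<theta> (oper B Join [x, y])" if "x \<in> carrier B" "y \<in> carrier B" for x y
      using that Join by (auto simp: set_representation_iff preserves_def)
    have disj: "\<theta> x \<inter> \<theta> y = {}"
      if "x \<in> carrier B" "y \<in> carrier B" "oper B Join [x, y] \<noteq> None" for x y
      using pr[OF that(1,2)] that(3) by (auto split: if_splits)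
    have mono: "\<theta> x \<subseteq> \<theta> y" if "x \<in> carrier B" "lesssim B x y" for x y
      using that(2) pr[OF that(1)] by (fastforce simp: lesssim_def split: if_splits)
    obtain p where "p \<in> \<theta> a" "p \<in> \<theta> b"
      using pr[OF a(1) b(1)] ab by (auto split: if_splits)
    then show False using contra[OF sets(2) _ _ _ disj] mono[OF a] by blast
  next
    case funs
    then have pr: "(if Domain (\<theta> x) \<inter> Domain (\<theta> y) = {} then Some (\<theta> x \<union> \<theta> y) else None)
        = map_option \<theta> (oper B Join [x, y])" if "x \<in> carrier B" "y \<in> carrier B" for x y
      using that Join by (auto simp: fun_representation_iff preserves_def)
    have disj: "\<theta> x \<inter> \<theta> y = {}"
      if "x \<in> carrier B" "y \<in> carrier B" "oper B Join [x, y] \<noteq> None" for x y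
      using pr[OF that(1,2)] that(3) by (auto split: if_splits)
    have mono: "\<theta> x \<subseteq> \<theta> y" if "x \<in> carrier B" "lesssim B x y" for x y
      using that(2) pr[OF that(1)] by (fastforce simp: lesssim_def split: if_splits)
    \<comment> \<open>Incombinability only yields a common argument \<open>x\<close>. The values
      agree because both graphs lie in the single-valued \<open>\<theta> t\<close>, which gives a
      common pair.\<close>
    obtain x y z where xy: "(x, y) \<in> \<theta> a" "(x, z) \<in> \<theta> b"
      using pr[OF a(1) b(1)] ab by (auto split: if_splits)
    moreover have "single_valued (\<theta> t)" using funs(1) t by (simp add: fun_representation_iff)
    ultimately have "y = z" using mono[OF a] mono[OF b] by (auto dest: single_valuedD)
    then show False using contra[OF funs(2) _ _ _ disj, of "(x, y)"] mono[OF a] xy by blast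
  qed
qed

section \<open>A hyperfinite block\<close>

text \<open>Coding by \<open>prod_encode\<close> makes different blocks disjoint. The points are
  reals so that the ultrapower can be named in the same type \<open>real set\<close>; see
  \<open>real_sequence_encoding\<close>.\<close>

definition pt :: "nat \<Rightarrow> nat \<Rightarrow> real" where
  "pt n k = real (prod_encode (n, k))"

definition block :: "nat \<Rightarrow> real set" where
  "block n = pt n ` {..<2 * n}"

lemma pt_eq_iff [simp]: "pt n k = pt m j \<longleftrightarrow> n = m \<and> k = j"
  by (simp add: pt_def)

lemma pt_in_block [simp]: "pt n k \<in> block m \<longleftrightarrow> n = m \<and> k < 2 * n"
  by (auto simp: block_def)

lemma block_in_even: "block n \<in> carrier (even_palg block)"
proof -
  have "inj_on (pt n) {..<2 * n}" by (rule inj_onI) simp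
  then have "card (block n) = 2 * n" by (simp add: block_def card_image)
  moreover have "block n \<inter> block m = (if n = m then block n else {})" for m
    by (auto simp: block_def)
  moreover have "finite (block n)" by (simp add: block_def)
  ultimately show ?thesis by (simp add: even_palg_carrier)
qed

lemma pair_in_even:
  assumes "j < 2 * n" "k < 2 * n" "j \<noteq> k"
  shows "{pt n j, pt n k} \<in> carrier (even_palg block)"
proof -
  have "{pt n j, pt n k} \<inter> block m = (if n = m then {pt n j, pt n k} else {})" for m
    using assms by auto
  then show ?thesis using assms by (simp add: even_palg_carrier)
qed

section \<open>The order and the matching in the ultrapower\<close>

text \<open>Coordinates and blocks share the index \<open>n\<close>, so the diagonal sequence
  \<open>block\<close> becomes one hyperfinite block; \<open>nonprincipal\<close> makes
  \<open>n\<close> exceed every standard number.\<close>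

locale even_upower = ultrapower U \<sigma> "even_palg block" h
  for U :: "nat filter" and \<sigma> and h :: "(nat \<Rightarrow> real set) \<Rightarrow> 'b" +
  assumes nonprincipal: "U \<le> sequentially"
    and Join: "Join \<in> abstract_sym ` \<sigma>"
begin

lemma eventually_gt: "\<forall>\<^sub>F n in U. m < n"
  using nonprincipal eventually_gt_at_top by (rule filter_leD)

lemma Join_defined_iff:
  "oper upower Join [x, y] \<noteq> None \<longleftrightarrow> (\<forall>\<^sub>F n in U. un x n \<inter> un y n = {})"
  unfolding oper_defined_iff by (simp add: even_palg_Join)

lemma upower_lesssim:
  assumes x: "x \<in> carrier upower" and y: "y \<in> carrier upower"
  shows "lesssim upower x y \<longleftrightarrow> (\<forall>\<^sub>F n in U. un x n \<subseteq> un y n)"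
proof
  assume "lesssim upower x y"
  then consider "x = y" | z where "z \<in> carrier upower" "oper upower Join [x, z] = Some y"
    unfolding lesssim_def by blast
  then show "\<forall>\<^sub>F n in U. un x n \<subseteq> un y n"
  proof cases
    case 2
    then have "\<forall>\<^sub>F n in U. oper (even_palg block) Join [un x n, un z n] = Some (un y n)"
      using oper_iff[OF Join, of "[x, z]" y] x y by (simp add: args_def)
    then show ?thesis by eventually_elim (auto simp: even_palg_Join split: if_splits)
  qed simp
next
  assume sub: "\<forall>\<^sub>F n in U. un x n \<subseteq> un y n"
  define z where "z = cls (\<lambda>n. un y n - un x n)"
  have ev: "\<forall>\<^sub>F n in U. un y n - un x n \<in> carrier (even_palg block)"
    using sub by eventually_elim (rule even_palg_Diff[OF un_in[OF x] un_in[OF y]])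
  have z: "z \<in> carrier upower" unfolding z_def by (rule cls_in_upower[OF ev])
  have "\<forall>\<^sub>F n in U. oper (even_palg block) Join [un x n, un z n] = Some (un y n)"
    using sub un_cls(2)[OF ev] unfolding z_def by eventually_elim (auto simp: even_palg_Join)
  then have "oper upower Join [x, z] = Some y"
    using oper_iff[OF Join, of "[x, z]" y] x y z by (simp add: args_def)
  then show "lesssim upower x y" using z unfolding lesssim_def by blast
qed

text \<open>The functions \<open>f\<close> and \<open>g\<close> stand for possibly nonstandard
  positions in the hyperfinite block.\<close>

definition pair :: "(nat \<Rightarrow> nat) \<Rightarrow> (nat \<Rightarrow> nat) \<Rightarrow> 'b" where
  "pair f g = cls (\<lambda>n. {pt n (f n), pt n (g n)})"

definition top_block :: 'b where
  "top_block = cls block"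

lemma top_block:
  "top_block \<in> carrier upower" "\<forall>\<^sub>F n in U. un top_block n = block n"
  unfolding top_block_def by (simp_all add: cls_in_upower un_cls block_in_even)

lemma pair:
  assumes "\<forall>\<^sub>F n in U. f n < 2 * n \<and> g n < 2 * n \<and> f n \<noteq> g n"
  shows "pair f g \<in> carrier upower"
    "\<forall>\<^sub>F n in U. un (pair f g) n = {pt n (f n), pt n (g n)}"
    "lesssim upower (pair f g) top_block"
proof -
  have ev: "\<forall>\<^sub>F n in U. {pt n (f n), pt n (g n)} \<in> carrier (even_palg block)"
    using assms by eventually_elim (simp add: pair_in_even)
  show 1: "pair f g \<in> carrier upower" unfolding pair_def by (rule cls_in_upower[OF ev])
  show 2: "\<forall>\<^sub>F n in U. un (pair f g) n = {pt n (f n), pt n (g n)}"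
    unfolding pair_def by (rule un_cls(2)[OF ev])
  show "lesssim upower (pair f g) top_block"
    unfolding upower_lesssim[OF 1 top_block(1)]
    using assms 2 top_block(2) by eventually_elim simp
qed

text \<open>
  An external matching of the hyperfinite block: below the standard cut the point 0 is skipped and
  \<open>2j + 1\<close> is matched with \<open>2j + 2\<close>, above it \<open>2k\<close> is matched with \<open>2k + 1\<close>, so that 0 is the only
  point left out.
\<close>

definition hyperinfinite :: "(nat \<Rightarrow> nat) \<Rightarrow> bool" where
  "hyperinfinite f \<longleftrightarrow> (\<forall>m. \<forall>\<^sub>F n in U. m < f n) \<and> (\<forall>\<^sub>F n in U. f n < n)"

definition std_pair :: "nat \<Rightarrow> 'b" where
  "std_pair j = pair (\<lambda>_. 2 * j + 1) (\<lambda>_. 2 * j + 2)"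

definition inf_pair :: "(nat \<Rightarrow> nat) \<Rightarrow> 'b" where
  "inf_pair f = pair (\<lambda>n. 2 * f n) (\<lambda>n. 2 * f n + 1)"

definition matching :: "'b set" where
  "matching = range std_pair \<union> inf_pair ` Collect hyperinfinite"

lemma std_pair:
  "std_pair j \<in> carrier upower"
  "\<forall>\<^sub>F n in U. un (std_pair j) n = {pt n (2 * j + 1), pt n (2 * j + 2)}"
  "lesssim upower (std_pair j) top_block"
proof -
  have "\<forall>\<^sub>F n in U. 2 * j + 1 < 2 * n \<and> 2 * j + 2 < 2 * n \<and> 2 * j + 1 \<noteq> 2 * j + 2"
    using eventually_gt[of "j + 1"] by eventually_elim auto
  note * = pair[OF this]
  show "std_pair j \<in> carrier upower"
    "\<forall>\<^sub>F n in U. un (std_pair j) n = {pt n (2 * j + 1), pt n (2 * j + 2)}"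
    "lesssim upower (std_pair j) top_block"
    unfolding std_pair_def by (fact *)+
qed

lemma inf_pair:
  assumes "hyperinfinite f"
  shows "inf_pair f \<in> carrier upower"
    "\<forall>\<^sub>F n in U. un (inf_pair f) n = {pt n (2 * f n), pt n (2 * f n + 1)}"
    "lesssim upower (inf_pair f) top_block"
proof -
  have "\<forall>\<^sub>F n in U. f n < n" using assms by (simp add: hyperinfinite_def)
  then have "\<forall>\<^sub>F n in U. 2 * f n < 2 * n \<and> 2 * f n + 1 < 2 * n \<and> 2 * f n \<noteq> 2 * f n + 1"
    by eventually_elim auto
  note * = pair[OF this]
  show "inf_pair f \<in> carrier upower"
    "\<forall>\<^sub>F n in U. un (inf_pair f) n = {pt n (2 * f n), pt n (2 * f n + 1)}"
    "lesssim upower (inf_pair f) top_block"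
    unfolding inf_pair_def by (fact *)+
qed

lemma matching_cases:
  assumes "s \<in> matching"
  obtains (std) j where "s = std_pair j" | (inf) f where "s = inf_pair f" "hyperinfinite f"
  using assms by (auto simp: matching_def)

lemma matching_subset: "matching \<subseteq> carrier upower"
  by (auto elim!: matching_cases simp: std_pair inf_pair)

lemma std_inf_disjoint:
  assumes "hyperinfinite f"
  shows "\<forall>\<^sub>F n in U. un (std_pair j) n \<inter> un (inf_pair f) n = {}"
proof -
  \<comment> \<open>This bound gives \<open>2 * j + 2 < 2 * f n\<close>, so the standard pair lies
    entirely below the other one.\<close>
  have "\<forall>\<^sub>F n in U. j + 1 < f n" using assms unfolding hyperinfinite_def by blast
  then show ?thesis using std_pair(2)[of j] inf_pair(2)[OF assms] by eventually_elim auto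
qed

lemma matching_combinable: "pairwise_combinable upower matching"
  unfolding pairwise_combinable_def Join_defined_iff
proof (intro ballI impI)
  fix s t assume "s \<in> matching" "t \<in> matching" "s \<noteq> t"
  then show "\<forall>\<^sub>F n in U. un s n \<inter> un t n = {}"
  proof (elim matching_cases)
    fix i j assume st: "s = std_pair i" "t = std_pair j"
    then have "i \<noteq> j" using \<open>s \<noteq> t\<close> by blast
    show ?thesis
      using std_pair(2)[of i] std_pair(2)[of j] unfolding st
    proof eventually_elim
      case (elim n)
      then show ?case using \<open>i \<noteq> j\<close> by (auto; presburger)
    qed
  next
    fix f g assume st: "s = inf_pair f" "t = inf_pair g" and fg: "hyperinfinite f" "hyperinfinite g"
    \<comment> \<open>Different functions may name the same pair. Distinctness in the ultrapower
      gives \<open>f n \<noteq> g n\<close> almost everywhere, by the ultrafilter property.\<close>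
    have "\<forall>\<^sub>F n in U. un s n \<noteq> un t n"
      using \<open>s \<noteq> t\<close> inf_pair(1)[OF fg(1)] inf_pair(1)[OF fg(2)]
      unfolding st by (simp add: upower_eq_iff not_eventually)
    then show ?thesis
      using inf_pair(2)[OF fg(1)] inf_pair(2)[OF fg(2)] unfolding st
    proof eventually_elim
      case (elim n)
      then have "f n \<noteq> g n" by auto
      then show ?case using elim(2,3) by (auto; presburger)
    qed
  next
    fix j f assume "s = std_pair j" "t = inf_pair f" "hyperinfinite f"
    then show ?thesis using std_inf_disjoint by simp
  next
    fix j f assume "s = inf_pair f" "hyperinfinite f" "t = std_pair j"
    then show ?thesis using std_inf_disjoint[of f j] by (simp add: Int_commute)
  qed
qed

text \<open>A position is either almost everywhere equal to a standard number, and lies in a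
  standard pair, or exceeds every standard number, and then its half indexes an infinite
  pair.\<close>

lemma matching_covers:
  assumes y: "\<forall>\<^sub>F n in U. 0 < y n \<and> y n < 2 * n"
  obtains s where "s \<in> matching" "\<forall>\<^sub>F n in U. pt n (y n) \<in> un s n"
proof (cases "\<exists>m. \<forall>\<^sub>F n in U. y n = m")
  case True
  then obtain m where m: "\<forall>\<^sub>F n in U. y n = m" by blast
  have "0 < m" using eventually_happens'[OF proper eventually_conj[OF m y]] by auto
  \<comment> \<open>Since \<open>m\<close> is positive, \<open>(m - 1) div 2\<close> is the index of
    the shifted pair containing it, for both parities.\<close>
  then have k: "m = 2 * ((m - 1) div 2) + 1 \<or> m = 2 * ((m - 1) div 2) + 2" by presburger
  have "\<forall>\<^sub>F n in U. pt n (y n) \<in> un (std_pair ((m - 1) div 2)) n"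
    using m std_pair(2)[of "(m - 1) div 2"] by eventually_elim (use k in auto)
  then show ?thesis by (intro that) (auto simp: matching_def)
next
  case False
  then have ne: "\<forall>\<^sub>F n in U. y n \<noteq> m" for m by (simp add: not_eventually)
  have "\<forall>\<^sub>F n in U. m < y n div 2" for m
  proof -
    \<comment> \<open>Exceeding a standard bound means avoiding finitely many constants, each
      avoided almost everywhere.\<close>
    have "\<forall>\<^sub>F n in U. \<forall>k\<in>{..2 * m + 1}. y n \<noteq> k"
      using ne by (intro eventually_ball_finite) auto
    then show ?thesis
    proof eventually_elim
      case (elim n)
      then have "2 * m + 1 < y n" by (metis atMost_iff linorder_not_le)
      then show ?case by linarith
    qed
  qed
  moreover have "\<forall>\<^sub>F n in U. y n div 2 < n" using y by eventually_elim auto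
  ultimately have inf: "hyperinfinite (\<lambda>n. y n div 2)" by (simp add: hyperinfinite_def)
  have "\<forall>\<^sub>F n in U. pt n (y n) \<in> un (inf_pair (\<lambda>n. y n div 2)) n"
    using inf_pair(2)[OF inf]
  proof eventually_elim
    case (elim n)
    have "y n = 2 * (y n div 2) \<or> y n = 2 * (y n div 2) + 1" by presburger
    then show ?case unfolding elim insert_iff pt_eq_iff by blast
  qed
  then show ?thesis using inf by (intro that) (auto simp: matching_def)
qed

text \<open>Evenness of the difference excludes that an upper bound misses only the point 0.\<close>

lemma matching_supremum: "is_supremum upower matching top_block"
  unfolding is_supremum_def
proof (intro conjI ballI impI)
  show "lesssim upower s top_block" if "s \<in> matching" for s
    using that by (auto elim!: matching_cases simp: std_pair inf_pair)
  fix u assume u: "u \<in> carrier upower" and ub: "\<forall>s\<in>matching. lesssim upower s u"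
  show "lesssim upower top_block u"
  proof (rule ccontr)
    assume "\<not> lesssim upower top_block u"
    then have ns: "\<forall>\<^sub>F n in U. \<not> un top_block n \<subseteq> un u n"
      by (simp add: upower_lesssim top_block(1) u not_eventually)
    \<comment> \<open>The missed nonzero points are collected into one nonstandard position, to
      which \<open>matching_covers\<close> applies; the covering pair would lie below
      \<open>u\<close>.\<close>
    define y where "y n = (SOME k. 0 < k \<and> k < 2 * n \<and> pt n k \<notin> un u n)" for n
    have y: "\<forall>\<^sub>F n in U. 0 < y n \<and> y n < 2 * n \<and> pt n (y n) \<notin> un u n"
      using ns top_block(2)
    proof eventually_elim
      case (elim n)
      have "\<exists>k. 0 < k \<and> k < 2 * n \<and> pt n k \<notin> un u n"
      proof (rule ccontr)
        assume "\<not> ?thesis"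
        then have "block n - un u n \<subseteq> {pt n 0}" by (auto simp: block_def)
        moreover have "block n - un u n \<noteq> {}" using elim by auto
        ultimately have "block n - un u n = {pt n 0}" by blast
        moreover have "card (block n - un u n) = card (block n) - card (un u n \<inter> block n)"
          using block_in_even[of n] by (simp add: even_palg_carrier card_Diff_subset_Int Int_commute)
        moreover have "even (card (block n))"
          using block_in_even[of n] unfolding even_palg_carrier by (metis Int_absorb)
        moreover have "even (card (un u n \<inter> block n))"
          using un_in[OF u, of n] by (simp add: even_palg_carrier)
        ultimately show False by (metis card_1_singleton_iff One_nat_def dvd_diff_nat odd_one)
      qed
      then show ?case unfolding y_def by (rule someI_ex)
    qed
    then have "\<forall>\<^sub>F n in U. 0 < y n \<and> y n < 2 * n" by eventually_elim simp
    then obtain s where s: "s \<in> matching" "\<forall>\<^sub>F n in U. pt n (y n) \<in> un s n"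
      by (rule matching_covers)
    have "\<forall>\<^sub>F n in U. un s n \<subseteq> un u n"
      using ub s(1) matching_subset upower_lesssim[OF _ u] by blast
    with y s(2) have "\<forall>\<^sub>F n in U. False" by eventually_elim blast
    then show False using proper by simp
  qed
qed (rule top_block(1))

lemma upower_not_completely_representable: "\<not> completely_representable \<sigma> upower"
proof (rule not_completely_representableI)
  \<comment> \<open>Both pairs contain 0, which no matching pair does. As 1 and 3 belong to the
    different pairs \<open>{1, 2}\<close> and \<open>{3, 4}\<close>, no matching pair meets
    both.\<close>
  let ?a = "pair (\<lambda>_. 0) (\<lambda>_. 1)" and ?b = "pair (\<lambda>_. 0) (\<lambda>_. 3)"
  have "\<forall>\<^sub>F n in U. 0 < 2 * n \<and> 1 < 2 * n \<and> (0::nat) \<noteq> 1"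
    using eventually_gt[of 1] by eventually_elim auto
  note a = pair[OF this]
  have "\<forall>\<^sub>F n in U. 0 < 2 * n \<and> 3 < 2 * n \<and> (0::nat) \<noteq> 3"
    using eventually_gt[of 2] by eventually_elim auto
  note b = pair[OF this]
  show "?a \<in> carrier upower" "lesssim upower ?a top_block"
    "?b \<in> carrier upower" "lesssim upower ?b top_block" by (fact a b)+
  have "\<forall>\<^sub>F n in U. un ?a n \<inter> un ?b n \<noteq> {}" using a(2) b(2) by eventually_elim auto
  then show "oper upower Join [?a, ?b] = None"
    using Join_defined_iff[of ?a ?b] by (simp add: not_eventually[symmetric])
  fix s assume "s \<in> matching"
  then show "oper upower Join [s, ?a] \<noteq> None \<or> oper upower Join [s, ?b] \<noteq> None"
  proof (cases rule: matching_cases)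
    case (std j)
    show ?thesis
    proof (cases "j = 0")
      case True
      have "\<forall>\<^sub>F n in U. un s n \<inter> un ?b n = {}"
        using std_pair(2)[of j] b(2) unfolding std True by eventually_elim auto
      then show ?thesis by (simp only: Join_defined_iff simp_thms)
    next
      case False
      have "\<forall>\<^sub>F n in U. un s n \<inter> un ?a n = {}"
        using std_pair(2)[of j] a(2) unfolding std by eventually_elim (use False in auto)
      then show ?thesis by (simp only: Join_defined_iff simp_thms)
    qed
  next
    case (inf f)
    \<comment> \<open>An infinite pair starts at position 2 or later, hence avoids 0 and 1.\<close>
    have "\<forall>\<^sub>F n in U. 0 < f n" using inf(2) unfolding hyperinfinite_def by blast
    then have "\<forall>\<^sub>F n in U. un s n \<inter> un ?a n = {}"
      using inf_pair(2)[OF inf(2)] a(2) unfolding inf by eventually_elim auto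
    then show ?thesis by (simp only: Join_defined_iff simp_thms)
  qed
qed (rule Join matching_subset matching_combinable matching_supremum)+

end

section \<open>Naming the ultrapower within the type of \<open>A\<close>\<close>

text \<open>A sequence of sets is coded by its disjoint sum in \<open>nat \<times> real\<close>.
  That product embeds into the reals: \<open>arctan\<close> squeezes each copy into an interval of
  length 4, and the copies are shifted by multiples of 4.\<close>

lemma real_sequence_encoding: "\<exists>h :: (nat \<Rightarrow> real set) \<Rightarrow> real set. inj h"
proof -
  define g where "g p = 4 * real (fst p) + arctan (snd p)" for p :: "nat \<times> real"
  have "inj g"
  proof (rule injI)
    fix p q assume eq: "g p = g q"
    have b: "\<bar>arctan x\<bar> < 2" for x using arctan_bounded[of x] pi_less_4 by auto
    have "\<bar>4 * real (fst p) - 4 * real (fst q)\<bar> < 4"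
      using eq b[of "snd p"] b[of "snd q"] unfolding g_def by linarith
    then have "fst p = fst q" by linarith
    then show "p = q" using eq by (simp add: g_def arctan_eq_iff prod_eq_iff)
  qed
  have "inj (\<lambda>f. g ` Sigma UNIV f)"
  proof (rule injI)
    fix f f' :: "nat \<Rightarrow> real set"
    assume "g ` Sigma UNIV f = g ` Sigma UNIV f'"
    then have "Sigma UNIV f = Sigma UNIV f'" using \<open>inj g\<close> by (simp add: inj_image_eq_iff)
    then show "f = f'" by (auto simp: fun_eq_iff set_eq_iff)
  qed
  then show ?thesis by blast
qed

theorem corollary5p8:
  assumes "\<sigma> \<in> {{DisjUnion}, {DomDisjUnion}, {DisjUnion, EmptySet}, {DomDisjUnion, EmptySet},
    {DomDisjUnion, Composition}, {DomDisjUnion, Composition, EmptySet}}"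
  shows "\<exists>(A :: real set palg) (B :: real set palg).
    partial_algebra \<sigma> A \<and> partial_algebra \<sigma> B \<and>
    completely_representable \<sigma> A \<and> elementarily_equivalent \<sigma> A B \<and>
    \<not> completely_representable \<sigma> B"
proof -
  \<comment> \<open>An ultrafilter below \<open>sequentially\<close> contains all cofinite sets, so
    it is nonprincipal.\<close>
  obtain U :: "nat filter" where U: "U \<noteq> bot" "U \<le> sequentially"
    "\<And>P. eventually P U \<or> eventually (\<lambda>n. \<not> P n) U"
    using ultrafilter_exists[OF sequentially_bot] by blast
  obtain h :: "(nat \<Rightarrow> real set) \<Rightarrow> real set" where "inj h" using real_sequence_encoding by blast
  interpret even_upower U \<sigma> h
  proof
    show "Join \<in> abstract_sym ` \<sigma>" using assms by auto
    show "inj_on h {f. \<forall>i. f i \<in> carrier (even_palg block)}"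
      using \<open>inj h\<close> by (rule inj_on_subset) simp
  qed (fact U fo_structure_even_palg)+
  have "elementarily_equivalent \<sigma> (even_palg block) upower"
    using block_in_even by (intro elementarily_equivalent_upower) blast
  moreover have "completely_representable \<sigma> (even_palg block)"
    using assms by (intro completely_representable_even_palg) auto
  ultimately show ?thesis
    using upower_not_completely_representable
    by (intro exI[of _ "even_palg block"] exI[of _ upower])
      (auto simp: elementarily_equivalent_def fo_structure_def)
qed

end
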